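(* Let $N\ge 0$ be an integer, let $\xi_0,\dots,\xi_N$ and $\omega_0,\dots,\omega_N$ be the nodes and weights of the $(N+1)$-point Gauss (Gauss–Legendre) quadrature rule on $[-1,1]$, and let $l_0,\dots,l_N$ be the associated Lagrange interpolating polynomials. Let $u_0,\dots,u_N$ be nodal states, let $u_{\tilde L},u_{\tilde R}$ be the corresponding entropy-projected face states, let $f^{\mathrm S}(\cdot,\cdot)\in\mathbb{R}^m$ be an entropy-conservative two-point flux, and let $f^{\star}_L,f^{\star}_R\in\mathbb{R}^m$ be the values of the numerical fluxes at the left and right faces of the element. Write $f^{\mathrm S}_{ab}=f^{\mathrm S}(u_a,u_b)$ for $a,b\in\{0,\dots,N,\tilde L,\tilde R\}$, and let $S=(S_{ij})_{i,j=0}^N$ be the matrix $$S_{ij}=2\,\omega_i\, l_j'(\xi_i)+l_i(-1)\,l_j(-1)-l_i(+1)\,l_j(+1).$$ Then the set of $N+3$ equations $$\bar f_0=f^{\star}_L,\qquad \bar f_{N+1}=f^{\star}_R,$$ $$\bar f_{i+1}=\bar f_i+\sum_{k=0}^N S_{ik}f^{\mathrm S}_{ik}-l_i(-1)\Big[f^{\mathrm S}_{i\tilde L}-\sum_{k=0}^N l_k(-1)f^{\mathrm S}_{\tilde L k}+f^{\star}_L\Big]+l_i(+1)\Big[f^{\mathrm S}_{i\tilde R}-\sum_{k=0}^N l_k(+1)f^{\mathrm S}_{\tilde R k}+f^{\star}_R\Big],\quad i=0,\dots,N,$$ for the $N+2$ unknowns $\bar f_0,\dots,\bar f_{N+1}\in\mathbb{R}^m$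 uniquely defines these interface fluxes; that is, there exists exactly one tuple $(\bar f_0,\dots,\bar f_{N+1})$ satisfying all of the equations.
   Context: The setting is the discontinuous Galerkin spectral element discretization with Gauss nodes, on one element with reference domain $[-1,1]$, of a one-dimensional conservation law $u_t+f(u)_x=0$ with states $u$ and fluxes $f(u)$ in $\mathbb{R}^m$, equipped with an entropy function and an invertible change of variables $u\mapsto v(u)$ to entropy variables, with inverse $v\mapsto u(v)$. Lagrange polynomials: $l_i$ is the polynomial of degree at most $N$ with $l_i(\xi_j)=\delta_{ij}$. Entropy-projected states: with $v_L=\sum_{k=0}^N l_k(-1)\,v(u_k)$ and $v_R=\sum_{k=0}^N l_k(+1)\,v(u_k)$ (assumed to lie in the domain of $v\mapsto u(v)$), set $u_{\tilde L}=u(v_L)$ and $u_{\tilde R}=u(v_R)$. Entropy-conservative two-point flux: a function $f^{\mathrm S}(u,w)\in\mathbb{R}^m$ of two states that is symmetric, $f^{\mathrm S}(u,w)=f^{\mathrm S}(w,u)$, consistent, $f^{\mathrm S}(u,u)=f(u)$, and satisfies Tadmor's condition $(v(u)-v(w))^{T}f^{\mathrm S}(u,w)=\psi(u)-\psi(w)$, where $\psi$ is the entropy flux potential. In matrix form $S=2WD-V_f^{T}BV_f$, where $W=\mathrm{diag}(\omega_0,\dots,\omega_N)$, $D_{ij}=l_j'(\xi_i)$, $B=\mathrm{diag}(-1,1)$, and $V_f$ is the $2\times(N+1)$ matrix with rows $(l_0(-1),\dots,l_N(-1))$ and $(l_0(+1),\dots,l_N(+1))$. The quantities $\bar f_0,\dots,\bar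 f_{N+1}$ are the interface (staggered) fluxes of the subcell grid, i.e. the fluxes at the $N+2$ interfaces of the $N+1$ subcells (of widths $\omega_0,\dots,\omega_N$) into which the element is divided. The flux values $f^{\star}_L,f^{\star}_R$ are regarded as given. *)

theory Defs
  imports "HOL-Analysis.Analysis" "HOL-Computational_Algebra.Polynomial"
begin

definition legendre_poly :: "nat \<Rightarrow> real poly" where
  (* Rodrigues' formula *)
  "legendre_poly n = smult (1 / (2 ^ n * fact n)) ((pderiv ^^ n) ([:-1, 0, 1:] ^ n))"

definition lagrange_poly :: "nat \<Rightarrow> (nat \<Rightarrow> real) \<Rightarrow> nat \<Rightarrow> real poly" where
  "lagrange_poly N \<xi> i =
    (THE p. degree p \<le> N \<and> (\<forall>j\<le>N. poly p (\<xi> j) = (if i = j then 1 else 0)))"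

lemma lagrange_poly_ex1:
  fixes \<xi> :: "nat \<Rightarrow> real"
  assumes inj: "inj_on \<xi> {..N}" and i: "i \<le> N"
  shows "\<exists>!p. degree p \<le> N \<and> (\<forall>j\<le>N. poly p (\<xi> j) = (if i = j then 1 else 0))"
proof (rule ex_ex1I)
  define A where "A = {..N} - {i}"
  define p where "p = (\<Prod>k\<in>A. smult (1 / (\<xi> i - \<xi> k)) [:- \<xi> k, 1:])"
  have cardA: "card A = N" using i by (simp add: A_def)
  have "degree p \<le> (\<Sum>k\<in>A. degree (smult (1 / (\<xi> i - \<xi> k)) [:- \<xi> k, 1:]))"
    unfolding p_def by (rule order_trans[OF degree_prod_sum_le]) (auto simp: A_def)
  also have "\<dots> \<le> (\<Sum>k\<in>A. 1)" by (intro sum_mono) auto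
  finally have deg: "degree p \<le> N" using cardA by simp
  have "poly p (\<xi> j) = (if i = j then 1 else 0)" if j: "j \<le> N" for j
  proof (cases "i = j")
    case True
    have "poly (smult (1 / (\<xi> i - \<xi> k)) [:- \<xi> k, 1:]) (\<xi> i) = 1" if "k \<in> A" for k
    proof -
      have "\<xi> i - \<xi> k \<noteq> 0" using that inj i by (auto simp: A_def inj_on_def)
      then show ?thesis by (simp flip: diff_divide_distrib)
    qed
    then show ?thesis using True by (simp add: p_def poly_prod)
  next
    case False
    then have "j \<in> A" using j by (auto simp: A_def)
    then have "(\<Prod>k\<in>A. poly (smult (1 / (\<xi> i - \<xi> k)) [:- \<xi> k, 1:]) (\<xi> j)) = 0"
      by (intro prod_zero bexI[of _ j]) (auto simp: A_def)
    then show ?thesis using False by (simp add: p_def poly_prod)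
  qed
  then show "\<exists>p. degree p \<le> N \<and> (\<forall>j\<le>N. poly p (\<xi> j) = (if i = j then 1 else 0))"
    using deg by blast
next
  fix p q :: "real poly"
  assume p: "degree p \<le> N \<and> (\<forall>j\<le>N. poly p (\<xi> j) = (if i = j then 1 else 0))"
    and q: "degree q \<le> N \<and> (\<forall>j\<le>N. poly q (\<xi> j) = (if i = j then 1 else 0))"
  show "p = q"
  proof (rule poly_eqI_degree[of "\<xi> ` {..N}"])
    show "\<And>x. x \<in> \<xi> ` {..N} \<Longrightarrow> poly p x = poly q x" using p q by auto
    show "degree p < card (\<xi> ` {..N})" "degree q < card (\<xi> ` {..N})"
      using p q by (simp_all add: card_image[OF inj])
  qed
qed

definition gauss_rule :: "nat \<Rightarrow> (nat \<Rightarrow> real) \<Rightarrow> (nat \<Rightarrow> real) \<Rightarrow> bool" where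
  (* In whatever order the nodes are numbered; the increasing numbering is one instance. *)
  "gauss_rule N \<xi> \<omega> \<longleftrightarrow>
    bij_betw \<xi> {..N} {x. poly (legendre_poly (Suc N)) x = 0} \<and>
    (\<forall>i\<le>N. \<omega> i = integral {-1..1} (poly (lagrange_poly N \<xi> i)))"

definition entropy_pair ::
  "(real ^ 'm) set \<Rightarrow> (real ^ 'm \<Rightarrow> real ^ 'm) \<Rightarrow> (real ^ 'm \<Rightarrow> real) \<Rightarrow> (real ^ 'm \<Rightarrow> real)
    \<Rightarrow> (real ^ 'm \<Rightarrow> real ^ 'm) \<Rightarrow> bool" where
  (* For u_t + f(u)_x = 0 on the open state set \<Omega>: entropy function \<eta>, entropy flux q, entropy
     variables v = \<nabla>\<eta>, and the compatibility relation q' = v^T f'. Convexity of \<eta> is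
     asked on the convex subsets only, since \<Omega> itself need not be convex. *)
  "entropy_pair \<Omega> f \<eta> q v \<longleftrightarrow>
    open \<Omega> \<and>
    (\<forall>C\<subseteq>\<Omega>. convex C \<longrightarrow> convex_on C \<eta>) \<and>
    (\<forall>u\<in>\<Omega>. (\<eta> has_derivative (\<lambda>h. v u \<bullet> h)) (at u)) \<and>
    (\<forall>u\<in>\<Omega>. \<exists>f'. (f has_derivative f') (at u) \<and> (q has_derivative (\<lambda>h. v u \<bullet> f' h)) (at u))"

definition entropy_flux_potential ::
  "(real ^ 'm \<Rightarrow> real ^ 'm) \<Rightarrow> (real ^ 'm \<Rightarrow> real) \<Rightarrow> (real ^ 'm \<Rightarrow> real ^ 'm) \<Rightarrow> real ^ 'm \<Rightarrow> real" where
  "entropy_flux_potential f q v u = v u \<bullet> f u - q u"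

definition entropy_conservative_flux ::
  "(real ^ 'm) set \<Rightarrow> (real ^ 'm \<Rightarrow> real ^ 'm) \<Rightarrow> (real ^ 'm \<Rightarrow> real ^ 'm) \<Rightarrow> (real ^ 'm \<Rightarrow> real)
    \<Rightarrow> (real ^ 'm \<Rightarrow> real ^ 'm \<Rightarrow> real ^ 'm) \<Rightarrow> bool" where
  "entropy_conservative_flux \<Omega> f v \<psi> fS \<longleftrightarrow>
    (\<forall>u\<in>\<Omega>. \<forall>w\<in>\<Omega>. fS u w = fS w u) \<and>
    (\<forall>u\<in>\<Omega>. fS u u = f u) \<and>
    (\<forall>u\<in>\<Omega>. \<forall>w\<in>\<Omega>. (v u - v w) \<bullet> fS u w = \<psi> u - \<psi> w)"

definition projected_entropy_vars ::
  "nat \<Rightarrow> (nat \<Rightarrow> real) \<Rightarrow> (real ^ 'm \<Rightarrow> real ^ 'm) \<Rightarrow> (nat \<Rightarrow> real ^ 'm) \<Rightarrow> real \<Rightarrow> real ^ 'm" where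
  "projected_entropy_vars N \<xi> v u x = (\<Sum>k\<le>N. poly (lagrange_poly N \<xi> k) x *\<^sub>R v (u k))"

definition S_mat :: "nat \<Rightarrow> (nat \<Rightarrow> real) \<Rightarrow> (nat \<Rightarrow> real) \<Rightarrow> nat \<Rightarrow> nat \<Rightarrow> real" where
  "S_mat N \<xi> \<omega> i j =
    2 * \<omega> i * poly (pderiv (lagrange_poly N \<xi> j)) (\<xi> i)
    + poly (lagrange_poly N \<xi> i) (-1) * poly (lagrange_poly N \<xi> j) (-1)
    - poly (lagrange_poly N \<xi> i) 1 * poly (lagrange_poly N \<xi> j) 1"

end

theory Submission
  imports Defs
begin

text \<open>
  The \<open>N + 1\<close> recurrences are increments \<open>fbar (i + 1) - fbar i = d i\<close>, so together with the left
  boundary value they already determine every interface flux; the content of the theorem is that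
  the one remaining equation \<open>fbar (N + 1) = fstarR\<close> is consistent with them, which is the
  telescoped condition \<open>(\<Sum>i\<le>N. d i) = fstarR - fstarL\<close> (lemma \<open>ex1_of_increments\<close>).

  The sum of the increments has a volume part and two face parts. In each face part, the averages
  of the two-point fluxes cancel by symmetry of \<open>fS\<close>, and the numerical flux survives with
  coefficient one because the Lagrange polynomials sum to one (lemmas \<open>face_contribution\<close> and
  \<open>sum_lagrange_poly\<close>). The volume part is \<open>\<Sum>i. \<Sum>k. S i k *\<^sub>R fS (u i) (u k)\<close>, a pairing of the
  matrix \<open>S\<close> with an array that is symmetric in \<open>i\<close> and \<open>k\<close>; it vanishes because \<open>S\<close> is
  skew-symmetric (lemma \<open>S_mat_skew\<close>).

  Skew-symmetry is the summation-by-parts property. The quadrature sum of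
  \<open>l\<^sub>i l\<^sub>j' + l\<^sub>i' l\<^sub>j = (l\<^sub>i l\<^sub>j)'\<close> collapses at the nodes to \<open>\<omega>\<^sub>i l\<^sub>j'(\<xi>\<^sub>i) + \<omega>\<^sub>j l\<^sub>i'(\<xi>\<^sub>j)\<close>, while exactness
  of Gauss quadrature makes it equal to the boundary terms of \<open>l\<^sub>i l\<^sub>j\<close>. Exactness in turn follows
  by division by the Legendre polynomial of degree \<open>N + 1\<close>: the quotient part vanishes at the nodes and
  has integral zero by orthogonality, and the remainder is integrated exactly by interpolation.
\<close>

section \<open>Orthogonality of the Legendre polynomials\<close>

lemma integral_poly_pderiv:
  fixes p :: "real poly"
  assumes "a \<le> b"
  shows "integral {a..b} (poly (pderiv p)) = poly p b - poly p a"
proof (rule integral_unique, rule fundamental_theorem_of_calculus[OF assms])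
  fix x assume "x \<in> {a..b}"
  show "(poly p has_vector_derivative poly (pderiv p) x) (at x within {a..b})"
    by (rule has_real_derivative_iff_has_vector_derivative[THEN iffD1,
        OF has_field_derivative_at_within[OF poly_DERIV]])
qed

lemma poly_integrable_on_interval: "poly p integrable_on {a..b}" for p :: "real poly"
  by (intro integrable_continuous_real continuous_intros)

lemma integral_poly_add:
  fixes p q :: "real poly"
  shows "integral {a..b} (poly (p + q)) = integral {a..b} (poly p) + integral {a..b} (poly q)"
  using integral_add[OF poly_integrable_on_interval[of p a b] poly_integrable_on_interval[of q a b]]
  by (simp add: poly_add[abs_def])

lemma integral_poly_smult:
  fixes p :: "real poly"
  shows "integral {a..b} (poly (smult c p)) = c * integral {a..b} (poly p)"
  by (simp add: poly_smult[abs_def])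

lemma power_dvd_pderiv:
  fixes c p :: "'a::idom poly"
  assumes "c ^ Suc k dvd p"
  shows "c ^ k dvd pderiv p"
proof -
  obtain s where "p = c ^ Suc k * s" using assms by (auto elim: dvdE)
  then have "pderiv p = c ^ k * (c * pderiv s + smult (of_nat (Suc k)) (pderiv c * s))"
    by (simp only: pderiv_mult pderiv_power_Suc) (simp add: algebra_simps)
  then show ?thesis by (metis dvd_triv_left)
qed

lemma power_dvd_higher_pderiv:
  fixes c p :: "'a::idom poly"
  assumes "c ^ (m + k) dvd p"
  shows "c ^ k dvd (pderiv ^^ m) p"
  using assms
proof (induction m arbitrary: k)
  case (Suc m)
  have "c ^ Suc k dvd (pderiv ^^ m) p" using Suc.prems by (intro Suc.IH) simp
  then show ?case by (simp add: power_dvd_pderiv)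
qed simp

lemma higher_pderiv_bump_vanishes:
  assumes "m < n" and a: "a = -1 \<or> a = (1::real)"
  shows "poly ((pderiv ^^ m) ([:-1, 0, 1:] ^ n)) a = 0"
proof -
  have "[:-1, 0, 1:] = [:-a, 1:] * [:a, 1:]" using a by auto
  then have "[:-a, 1:] ^ (m + (n - m)) dvd [:-1, 0, 1:] ^ n"
    using assms by (simp only: power_mult_distrib) simp
  then have "[:-a, 1:] ^ (n - m) dvd (pderiv ^^ m) ([:-1, 0, 1:] ^ n)"
    by (rule power_dvd_higher_pderiv)
  moreover have "[:-a, 1:] dvd [:-a, 1:] ^ (n - m)"
    using assms by (intro dvd_power) auto
  ultimately have "[:-a, 1:] dvd (pderiv ^^ m) ([:-1, 0, 1:] ^ n)" by (rule dvd_trans[rotated])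
  then show ?thesis by (simp add: poly_eq_0_iff_dvd)
qed

lemma degree_higher_pderiv:
  fixes p :: "real poly"
  shows "degree ((pderiv ^^ m) p) = degree p - m"
  by (induction m) (simp_all add: degree_pderiv)

text \<open>Each integration by parts moves one derivative from \<open>(x\<^sup>2 - 1) ^ n\<close> onto \<open>q\<close>; the boundary terms
  vanish since at most \<open>n - 1\<close> derivatives remain on the factor with \<open>n\<close>-fold zeros at
  \<open>-1\<close> and \<open>1\<close>. Annihilation of \<open>q\<close> by \<open>m\<close> derivatives, rather than a degree bound, is the
  hypothesis that the induction preserves without a special case for constants.\<close>

lemma integral_mult_higher_pderiv_bump:
  assumes "m \<le> n" and "(pderiv ^^ m) q = 0"
  shows "integral {-1..1::real} (poly (q * (pderiv ^^ m) ([:-1, 0, 1:] ^ n))) = 0"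
  using assms
proof (induction m arbitrary: q)
  case 0
  then show ?case by simp
next
  case (Suc m)
  define w where "w = (pderiv ^^ m) ([:-1, 0, 1::real:] ^ n)"
  have bd: "poly w 1 = 0" "poly w (-1) = 0"
    using Suc.prems by (simp_all add: w_def higher_pderiv_bump_vanishes)
  have "(pderiv ^^ m) (pderiv q) = 0"
    using Suc.prems(2) by (simp add: funpow_swap1)
  then have ih: "integral {-1..1} (poly (pderiv q * w)) = 0"
    using Suc.prems(1) unfolding w_def by (intro Suc.IH) simp_all
  have "integral {-1..1} (poly (pderiv (q * w))) = 0"
    using bd by (simp only: integral_poly_pderiv) simp
  moreover have "pderiv (q * w) = q * pderiv w + pderiv q * w"
    by (simp add: pderiv_mult)
  ultimately have "integral {-1..1} (poly (q * pderiv w)) = 0"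
    using ih by (simp only: integral_poly_add)
  then show ?case by (simp only: w_def funpow.simps o_apply)
qed

lemma degree_legendre_poly: "degree (legendre_poly n) = n"
  by (simp add: legendre_poly_def degree_higher_pderiv degree_power_eq)

lemma legendre_poly_orthogonal:
  assumes "degree q < n"
  shows "integral {-1..1} (poly (q * legendre_poly n)) = 0"
proof -
  have "degree ((pderiv ^^ (n - 1)) q) = 0" using assms by (simp add: degree_higher_pderiv)
  then have "pderiv ((pderiv ^^ (n - 1)) q) = 0" by (simp add: pderiv_eq_0_iff)
  then have "(pderiv ^^ Suc (n - 1)) q = 0" by simp
  then have "(pderiv ^^ n) q = 0" using assms by simp
  then show ?thesis
    using integral_mult_higher_pderiv_bump[of n n q]
    by (simp add: legendre_poly_def integral_poly_smult del: poly_mult poly_smult)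
qed

section \<open>Lagrange interpolation and Gauss quadrature\<close>

lemma lagrange_poly_props:
  assumes "inj_on \<xi> {..N}" and "i \<le> N"
  shows "degree (lagrange_poly N \<xi> i) \<le> N"
    and "\<And>j. j \<le> N \<Longrightarrow> poly (lagrange_poly N \<xi> i) (\<xi> j) = (if i = j then 1 else 0)"
  using theI'[OF lagrange_poly_ex1[OF assms]] unfolding lagrange_poly_def by auto

lemma lagrange_interpolation:
  assumes inj: "inj_on \<xi> {..N}" and deg: "degree p \<le> N"
  shows "p = (\<Sum>k\<le>N. smult (poly p (\<xi> k)) (lagrange_poly N \<xi> k))"
proof (rule poly_eqI_degree[of "\<xi> ` {..N}"])
  show "degree p < card (\<xi> ` {..N})" using deg by (simp add: card_image[OF inj])
  have "degree (\<Sum>k\<le>N. smult (poly p (\<xi> k)) (lagrange_poly N \<xi> k)) \<le> N"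
    using lagrange_poly_props(1)[OF inj]
    by (intro degree_sum_le) (auto intro: order_trans[OF degree_smult_le])
  then show "degree (\<Sum>k\<le>N. smult (poly p (\<xi> k)) (lagrange_poly N \<xi> k)) < card (\<xi> ` {..N})"
    by (simp add: card_image[OF inj])
  fix x assume "x \<in> \<xi> ` {..N}"
  then obtain j where "j \<le> N" "x = \<xi> j" by auto
  then show "poly p x = poly (\<Sum>k\<le>N. smult (poly p (\<xi> k)) (lagrange_poly N \<xi> k)) x"
    by (simp add: poly_sum lagrange_poly_props(2)[OF inj] if_distrib cong: if_cong)
qed

lemma sum_lagrange_poly:
  assumes "inj_on \<xi> {..N}"
  shows "(\<Sum>k\<le>N. poly (lagrange_poly N \<xi> k) x) = 1"
proof -
  have "1 = poly (\<Sum>k\<le>N. smult (poly 1 (\<xi> k)) (lagrange_poly N \<xi> k)) x"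
    using lagrange_interpolation[OF assms, of 1] by simp
  then show ?thesis by (simp add: poly_sum)
qed

lemma gauss_rule_inj: "gauss_rule N \<xi> \<omega> \<Longrightarrow> inj_on \<xi> {..N}"
  by (simp add: gauss_rule_def bij_betw_def)

text \<open>The weights are the integrals of the Lagrange polynomials, so the quadrature sum is the integral
  of the interpolant, which is \<open>p\<close> itself in this degree range.\<close>

lemma interpolatory_quadrature_exact:
  assumes gauss: "gauss_rule N \<xi> \<omega>" and deg: "degree p \<le> N"
  shows "integral {-1..1} (poly p) = (\<Sum>k\<le>N. \<omega> k * poly p (\<xi> k))"
proof -
  let ?l = "lagrange_poly N \<xi>"
  have "poly p = (\<lambda>x. \<Sum>k\<le>N. poly p (\<xi> k) * poly (?l k) x)"
    by (subst lagrange_interpolation[OF gauss_rule_inj[OF gauss] deg]) (auto simp: poly_sum)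
  then have "integral {-1..1} (poly p) = integral {-1..1} (\<lambda>x. \<Sum>k\<le>N. poly p (\<xi> k) * poly (?l k) x)"
    by simp
  also have "\<dots> = (\<Sum>k\<le>N. integral {-1..1} (\<lambda>x. poly p (\<xi> k) * poly (?l k) x))"
    by (intro integral_sum integrable_continuous_real continuous_intros) auto
  also have "\<dots> = (\<Sum>k\<le>N. \<omega> k * poly p (\<xi> k))"
    using gauss by (intro sum.cong) (auto simp: gauss_rule_def mult.commute)
  finally show ?thesis .
qed

text \<open>Dividing by the Legendre polynomial with the nodes as roots leaves a remainder of degree at
  most \<open>N\<close>, and a quotient of degree at most \<open>N\<close>, to which that Legendre polynomial is orthogonal.\<close>

theorem gauss_quadrature_exact:
  assumes gauss: "gauss_rule N \<xi> \<omega>" and deg: "degree p \<le> 2 * N + 1"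
  shows "integral {-1..1} (poly p) = (\<Sum>k\<le>N. \<omega> k * poly p (\<xi> k))"
proof -
  define P where "P = legendre_poly (Suc N)"
  have degP: "degree P = Suc N" by (simp add: P_def degree_legendre_poly)
  then have "P \<noteq> 0" by auto
  have root: "poly P (\<xi> k) = 0" if "k \<le> N" for k
    using gauss that by (auto simp: gauss_rule_def bij_betw_def P_def)
  have decomp: "p = (p div P) * P + p mod P" by simp
  have "degree (p div P) < Suc N"
  proof -
    have "degree (p mod P) \<le> 2 * N + 1"
      using degree_mod_less[OF \<open>P \<noteq> 0\<close>, of p] degP by auto
    then have "degree ((p div P) * P) \<le> 2 * N + 1"
      using degree_diff_le[OF deg] by (metis minus_mod_eq_div_mult)
    then show ?thesis
      using degP \<open>P \<noteq> 0\<close> by (cases "p div P = 0") (simp_all add: degree_mult_eq)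
  qed
  then have orth: "integral {-1..1} (poly ((p div P) * P)) = 0"
    unfolding P_def by (rule legendre_poly_orthogonal)
  have degr: "degree (p mod P) \<le> N"
    using degree_mod_less[OF \<open>P \<noteq> 0\<close>, of p] degP by auto
  have "integral {-1..1} (poly p) = integral {-1..1} (poly (p mod P))"
    by (subst decomp, subst integral_poly_add) (simp only: orth add_0)
  also have "\<dots> = (\<Sum>k\<le>N. \<omega> k * poly (p mod P) (\<xi> k))"
    by (rule interpolatory_quadrature_exact[OF gauss degr])
  also have "\<dots> = (\<Sum>k\<le>N. \<omega> k * poly p (\<xi> k))"
  proof (intro sum.cong refl)
    fix k assume "k \<in> {..N}"
    then have "poly p (\<xi> k) = poly (p mod P) (\<xi> k)"
      by (subst decomp, subst poly_add, subst poly_mult) (simp add: root)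
    then show "\<omega> k * poly (p mod P) (\<xi> k) = \<omega> k * poly p (\<xi> k)" by simp
  qed
  finally show ?thesis .
qed

section \<open>Skew-symmetry and cancellation of the volume and face terms\<close>

text \<open>Both sides of the fundamental theorem of calculus for the product of two Lagrange polynomials
  appear in \<open>S i j + S j i\<close>: Gauss quadrature is exact for the derivative of that product, whose
  degree is below \<open>2 * N + 1\<close>, and at the nodes only the terms at \<open>\<xi> i\<close> and \<open>\<xi> j\<close> survive.\<close>

lemma S_mat_skew:
  assumes gauss: "gauss_rule N \<xi> \<omega>" and i: "i \<le> N" and j: "j \<le> N"
  shows "S_mat N \<xi> \<omega> i j = - S_mat N \<xi> \<omega> j i"
proof -
  define a where "a = lagrange_poly N \<xi> i"
  define b where "b = lagrange_poly N \<xi> j"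
  note inj = gauss_rule_inj[OF gauss]
  have vals: "poly a (\<xi> k) = (if i = k then 1 else 0)" "poly b (\<xi> k) = (if j = k then 1 else 0)"
    if "k \<le> N" for k
    using lagrange_poly_props(2)[OF inj] i j that by (simp_all add: a_def b_def)
  have "degree (a * b) \<le> N + N"
    unfolding a_def b_def
    by (intro order_trans[OF degree_mult_le] add_mono lagrange_poly_props(1)[OF inj] i j)
  then have "degree (pderiv (a * b)) \<le> 2 * N + 1" by (simp add: degree_pderiv)
  from gauss_quadrature_exact[OF gauss this]
  have "poly (a * b) 1 - poly (a * b) (-1) = (\<Sum>k\<le>N. \<omega> k * poly (pderiv (a * b)) (\<xi> k))"
    by (simp only: integral_poly_pderiv)
  also have "\<dots> = (\<Sum>k\<le>N. (if i = k then \<omega> k * poly (pderiv b) (\<xi> k) else 0)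
                     + (if j = k then \<omega> k * poly (pderiv a) (\<xi> k) else 0))"
    by (intro sum.cong) (auto simp: pderiv_mult vals algebra_simps)
  also have "\<dots> = \<omega> i * poly (pderiv b) (\<xi> i) + \<omega> j * poly (pderiv a) (\<xi> j)"
    using i j by (simp add: sum.distrib)
  finally show ?thesis
    unfolding S_mat_def a_def[symmetric] b_def[symmetric] by (simp add: algebra_simps)
qed

lemma sum_skew_scaleR_symmetric:
  fixes F :: "'a \<Rightarrow> 'a \<Rightarrow> 'b::real_vector"
  assumes skew: "\<And>i k. i \<in> A \<Longrightarrow> k \<in> A \<Longrightarrow> S i k = - S k i"
    and sym: "\<And>i k. i \<in> A \<Longrightarrow> k \<in> A \<Longrightarrow> F i k = F k i"
  shows "(\<Sum>i\<in>A. \<Sum>k\<in>A. S i k *\<^sub>R F i k) = 0"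
proof -
  let ?T = "\<Sum>i\<in>A. \<Sum>k\<in>A. S i k *\<^sub>R F i k"
  have "?T = (\<Sum>k\<in>A. \<Sum>i\<in>A. S i k *\<^sub>R F i k)" by (rule sum.swap)
  also have "\<dots> = (\<Sum>k\<in>A. \<Sum>i\<in>A. - (S k i *\<^sub>R F k i))"
  proof (intro sum.cong refl)
    fix i k assume *: "k \<in> A" "i \<in> A"
    show "S i k *\<^sub>R F i k = - (S k i *\<^sub>R F k i)"
      using skew[OF *(2) *(1)] sym[OF *(2) *(1)] by simp
  qed
  also have "\<dots> = - ?T" by (simp add: sum_negf)
  finally have "?T + ?T = 0" by (simp only: eq_neg_iff_add_eq_0)
  then have "2 *\<^sub>R ?T = 0" by (simp only: scaleR_2)
  then show ?thesis by simp
qed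

text \<open>The bracket at a face is the deviation of each two-point flux from their extrapolated average,
  plus the numerical flux; extrapolating the deviations gives zero.\<close>

lemma face_contribution:
  fixes g :: "'a \<Rightarrow> 'b::real_vector"
  assumes "(\<Sum>i\<in>A. c i) = 1"
  shows "(\<Sum>i\<in>A. c i *\<^sub>R (g i - (\<Sum>k\<in>A. c k *\<^sub>R g k) + F)) = F"
  using assms
  by (simp only: scaleR_add_right scaleR_diff_right sum.distrib sum_subtractf
      scaleR_sum_left[symmetric]) simp

section \<open>Sequences with prescribed increments and both end values\<close>

lemma ex1_of_increments:
  fixes a b :: "'a::ab_group_add" and d :: "nat \<Rightarrow> 'a"
  assumes total: "(\<Sum>i\<le>N. d i) = b - a"
  shows "\<exists>!g. g \<in> {0..N + 1} \<rightarrow>\<^sub>E UNIV \<and> g 0 = a \<and> g (N + 1) = b \<and>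
    (\<forall>i\<le>N. g (i + 1) = g i + d i)"
proof (rule ex_ex1I)
  let ?g = "restrict (\<lambda>i. a + (\<Sum>j<i. d j)) {0..N + 1}"
  have "?g (N + 1) = b" using total by (simp add: lessThan_Suc_atMost)
  then show "\<exists>g. g \<in> {0..N + 1} \<rightarrow>\<^sub>E UNIV \<and> g 0 = a \<and> g (N + 1) = b \<and>
      (\<forall>i\<le>N. g (i + 1) = g i + d i)"
    by (intro exI[of _ ?g]) (auto simp: add.assoc)
next
  fix g h
  assume g: "g \<in> {0..N + 1} \<rightarrow>\<^sub>E UNIV \<and> g 0 = a \<and> g (N + 1) = b \<and>
      (\<forall>i\<le>N. g (i + 1) = g i + d i)"
    and h: "h \<in> {0..N + 1} \<rightarrow>\<^sub>E UNIV \<and> h 0 = a \<and> h (N + 1) = b \<and>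
      (\<forall>i\<le>N. h (i + 1) = h i + d i)"
  have "g i = h i" if "i \<le> N + 1" for i
    using that by (induction i) (use g h in auto)
  then show "g = h" using g h by (intro PiE_ext[of g "{0..N + 1}" _ h]) auto
qed

section \<open>Unique solvability for the interface fluxes\<close>

theorem theorem1:
  fixes N :: nat and \<xi> \<omega> :: "nat \<Rightarrow> real"
    and \<Omega> :: "(real ^ 'm) set"
    and f v :: "real ^ 'm \<Rightarrow> real ^ 'm" and \<eta> q :: "real ^ 'm \<Rightarrow> real"
    and fS :: "real ^ 'm \<Rightarrow> real ^ 'm \<Rightarrow> real ^ 'm"
    and u :: "nat \<Rightarrow> real ^ 'm" and uL uR fstarL fstarR :: "real ^ 'm"
    and l :: "nat \<Rightarrow> real poly"
  assumes gauss: "gauss_rule N \<xi> \<omega>"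
    and lagrange: "\<And>i. i \<le> N \<Longrightarrow> l i = lagrange_poly N \<xi> i"
    and entropy: "entropy_pair \<Omega> f \<eta> q v"
    and invertible: "inj_on v \<Omega>"
    and states: "\<And>i. i \<le> N \<Longrightarrow> u i \<in> \<Omega>"
    and vL: "projected_entropy_vars N \<xi> v u (-1) \<in> v ` \<Omega>"
    and vR: "projected_entropy_vars N \<xi> v u 1 \<in> v ` \<Omega>"
    and uL: "uL = the_inv_into \<Omega> v (projected_entropy_vars N \<xi> v u (-1))"
    and uR: "uR = the_inv_into \<Omega> v (projected_entropy_vars N \<xi> v u 1)"
    and flux: "entropy_conservative_flux \<Omega> f v (entropy_flux_potential f q v) fS"
  shows "\<exists>!fbar. fbar \<in> {0..N + 1} \<rightarrow>\<^sub>E (UNIV :: (real ^ 'm) set) \<and>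
    fbar 0 = fstarL \<and> fbar (N + 1) = fstarR \<and>
    (\<forall>i\<le>N. fbar (i + 1) = fbar i + (\<Sum>k\<le>N. S_mat N \<xi> \<omega> i k *\<^sub>R fS (u i) (u k))
      - poly (l i) (-1) *\<^sub>R
          (fS (u i) uL - (\<Sum>k\<le>N. poly (l k) (-1) *\<^sub>R fS uL (u k)) + fstarL)
      + poly (l i) 1 *\<^sub>R
          (fS (u i) uR - (\<Sum>k\<le>N. poly (l k) 1 *\<^sub>R fS uR (u k)) + fstarR))"
proof -
  note inj = gauss_rule_inj[OF gauss]
  (* The face states are admissible, so symmetry of the two-point flux applies to them. *)
  have faces: "uL \<in> \<Omega>" "uR \<in> \<Omega>"
    unfolding uL uR
    by (rule the_inv_into_into[OF invertible vL order_refl],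
        rule the_inv_into_into[OF invertible vR order_refl])
  have sym: "fS x y = fS y x" if "x \<in> \<Omega>" "y \<in> \<Omega>" for x y
    using flux that by (simp add: entropy_conservative_flux_def)
  have unity: "(\<Sum>i\<le>N. poly (l i) x) = 1" for x
    using sum_lagrange_poly[OF inj, of x] by (simp add: lagrange)
  define vol where "vol i = (\<Sum>k\<le>N. S_mat N \<xi> \<omega> i k *\<^sub>R fS (u i) (u k))" for i
  define face where "face x w F i = poly (l i) x *\<^sub>R
      (fS (u i) w - (\<Sum>k\<le>N. poly (l k) x *\<^sub>R fS w (u k)) + F)" for x w F i
  have volume: "(\<Sum>i\<le>N. vol i) = 0"
    unfolding vol_def
    by (rule sum_skew_scaleR_symmetric[OF S_mat_skew[OF gauss] sym[OF states states]]) simp_all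
  have face_sum: "(\<Sum>i\<le>N. face x w F i) = F" if w: "w \<in> \<Omega>" for x w F
  proof -
    have "(\<Sum>k\<le>N. poly (l k) x *\<^sub>R fS w (u k)) = (\<Sum>k\<le>N. poly (l k) x *\<^sub>R fS (u k) w)"
      using sym[OF w states] by (intro sum.cong) auto
    then show ?thesis unfolding face_def by (simp only: face_contribution[OF unity])
  qed
  have "(\<Sum>i\<le>N. vol i - face (-1) uL fstarL i + face 1 uR fstarR i) = fstarR - fstarL"
    by (simp add: sum.distrib sum_subtractf volume face_sum faces)
  from ex1_of_increments[OF this] show ?thesis
    unfolding vol_def face_def by (simp only: add_diff_eq add.assoc[symmetric])
qed

end
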